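(* Let $\mathcal{D}$ be any normal and neutral domain and let $m_0=\min\{m:\mathrm{con}_{\mathcal{D}}(m)<1\}$. If the number of alternatives is at least $m_0$, then for every $0\le\varepsilon_v<1$ and $0<\delta<1/2$ there exists an $(\varepsilon_v,0,\delta,\mathcal{D})$-Random Outliers vs Random Profile Tester with sample complexity $O\left(\frac{1}{(1-\varepsilon_v)^2}\ln\frac{1}{\delta}\right)$. If the number of alternatives is at most $m_0-1$, then there does not exist any such tester.
   Context: Profiles and domains. Let $\mathcal{A}$ be a finite set of $m$ alternatives and $\mathcal{L}(\mathcal{A})$ the set of linear orders (preferences) over $\mathcal{A}$; for $\mathcal{X}\subseteq\mathcal{A}$, $\succ(\mathcal{X})$ is the restriction of $\succ$ to $\mathcal{X}$. A profile is a tuple $(\succ_i)_{i\in[n]}$ of $n$ preferences over $\mathcal{A}$, one per agent. A domain $\mathcal{D}$ is a collection of subsets of $\bigcup_{|\mathcal{A}|>0}\mathcal{L}(\mathcal{A})$; a profile $\mathcal{P}$ of $n$ preferences belongs to $\mathcal{D}$ (written $\mathcal{P}\in\mathcal{D}$) if there is $\mathcal{B}\in\mathcal{D}$ with $\mathcal{P}\in\mathcal{B}^n$. $\mathcal{D}$ is neutral if membership of profiles in $\mathcal{D}$ is preserved under renaming the alternatives by any permutation (the same for all preferences of the profile). $\mathcal{D}$ is normal if $(\succ_i)_{i\in[n]}\in\mathcal{D}$ implies $(\succ_i(\mathcal{X}))_{i\in[n]}\in\mathcal{D}$ for every $\mathcal{X}\subseteq\mathcal{A}$. The content of $\mathcal{D}$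 is the function $\mathrm{con}_{\mathcal{D}}:\mathbb{N}\to[0,1]$ such that $\mathrm{con}_{\mathcal{D}}(m)\,m!$ is the maximum number of distinct preferences in a profile over $m$ alternatives belonging to $\mathcal{D}$; by convention $\mathrm{con}_{\mathcal{D}}(1)=1$. Sampling model. An oracle, when queried, returns an agent picked uniformly at random with replacement from the set of all $n$ agents. The algorithm may then ask this agent arbitrarily many comparison queries: given two alternatives $x,y$, the agent replies which of the two it prefers. The sample complexity of an algorithm is the total number of comparison queries it makes. The domain $\mathcal{D}$ is fixed; the constant in $O(\cdot)$ may depend on $m_0$. Problem. An $(\varepsilon_v,0,\delta,\mathcal{D})$-Random Outliers vs Random Profile Tester is a (randomized) algorithm in this model which, given a profile $(\succ_i)_{i\in[n]}$ over $\mathcal{A}$ that is of one of the following two kinds, outputs $1$ if it is of kind (i) and $0$ if it is of kind (ii), with error probability at most $\delta$: (i) there exists $\mathcal{W}\subseteq[n]$ with $|\mathcal{W}|\ge(1-\varepsilon_v)n$ such that $(\succ_i)_{i\in\mathcal{W}}\in\mathcal{D}$, and for every $j\in[n]\setminus\mathcal{W}$, $\succ_j$ is distributed (independently) uniformly in $\mathcal{L}(\mathcal{A})$; (ii) for every $i\in[n]$, $\succ_i$ is distributed (independently) uniformly in $\mathcal{L}(\mathcal{A})$. The error probability is over the randomness generating the instance and the randomness of the algorithm (including the oracle).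
   Formalization: The tester is claimed only for a number n of agents above a threshold depending on m_0, ε_v and δ (for n = 1 it cannot exist); the domain must contain at least one preference, and neutrality covers renaming to other alternative sets of equal size. *)

theory Defs
  imports
    "HOL-Probability.Product_PMF"
    "HOL-Library.Extended_Nat"
    "HOL-Library.Extended_Real"
    "HOL-Library.Infinite_Typeclass"
begin

section \<open>Preferences, profiles and domains\<close>

text \<open>
  Preferences are reflexive linear orders, where \<open>(x, y) \<in> r\<close> for \<open>x \<noteq> y\<close> means that \<open>x\<close> is
  preferred to \<open>y\<close>. With the reflexive version the relation determines its set of alternatives,
  so preferences over different sets are different, also when the sets are singletons.
\<close>

definition prefs :: "'a set \<Rightarrow> 'a rel set" where
  "prefs A = {r. linear_order_on A r}"

definition rename :: "('a \<Rightarrow> 'a) \<Rightarrow> 'a rel \<Rightarrow> 'a rel" where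
  "rename \<sigma> r = map_prod \<sigma> \<sigma> ` r"

text \<open>
  A family of preferences is a function on agents, of which only the values on the index set \<open>I\<close>
  matter; a profile of \<open>n\<close> preferences has the index set \<open>{..<n}\<close>.
\<close>

definition profile_over :: "'a set \<Rightarrow> nat set \<Rightarrow> (nat \<Rightarrow> 'a rel) \<Rightarrow> bool" where
  "profile_over A I P \<longleftrightarrow> (\<forall>i\<in>I. P i \<in> prefs A)"

definition is_domain :: "'a rel set set \<Rightarrow> bool" where
  "is_domain D \<longleftrightarrow> (\<forall>B\<in>D. B \<subseteq> (\<Union>A\<in>{A. finite A \<and> A \<noteq> {}}. prefs A))"

definition belongs :: "'a rel set set \<Rightarrow> nat set \<Rightarrow> (nat \<Rightarrow> 'a rel) \<Rightarrow> bool" where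
  "belongs D I P \<longleftrightarrow> (\<exists>B\<in>D. \<forall>i\<in>I. P i \<in> B)"

text \<open>
  The permutations range over the whole universe of alternatives. As every bijection between two
  finite sets extends to such a permutation, a neutral domain treats all sets of alternatives of
  the same size alike.
\<close>

definition neutral_domain :: "'a rel set set \<Rightarrow> bool" where
  "neutral_domain D \<longleftrightarrow>
     (\<forall>A n P \<sigma>. finite A \<longrightarrow> A \<noteq> {} \<longrightarrow> profile_over A {..<n} P \<longrightarrow> bij \<sigma> \<longrightarrow>
        belongs D {..<n} P \<longrightarrow> belongs D {..<n} (\<lambda>i. rename \<sigma> (P i)))"

definition normal_domain :: "'a rel set set \<Rightarrow> bool" where
  "normal_domain D \<longleftrightarrow>
     (\<forall>A n P X. finite A \<longrightarrow> profile_over A {..<n} P \<longrightarrow> X \<subseteq> A \<longrightarrow> X \<noteq> {} \<longrightarrow>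
        belongs D {..<n} P \<longrightarrow> belongs D {..<n} (\<lambda>i. Restr (P i) X))"

text \<open>Intended for \<open>m > 0\<close>. The maximum is over a set of numbers bounded by \<open>m!\<close>.\<close>

definition con :: "'a rel set set \<Rightarrow> nat \<Rightarrow> real" where
  "con D m =
     (if m = 1 then 1
      else real (Max {card (P ` {..<n}) | A n P. finite A \<and> card A = m \<and>
                        profile_over A {..<n} P \<and> belongs D {..<n} P}) / fact m)"

text \<open>The value is \<open>\<infinity>\<close> if the content is \<open>1\<close> for every number of alternatives.\<close>

definition m0 :: "'a rel set set \<Rightarrow> enat" where
  "m0 D = (INF m\<in>{m. 0 < m \<and> con D m < 1}. enat m)"


section \<open>The sampling model\<close>

text \<open>
  A randomized adaptive algorithm stops with a verdict (\<open>True\<close> for 1, \<open>False\<close> for 0), makes an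
  internal random choice, queries the oracle and receives an agent, or asks an agent to compare
  two alternatives and receives \<open>True\<close> iff the agent prefers the first one.
\<close>

datatype 'a algorithm =
    Output bool
  | Toss "'a algorithm pmf"
  | Sample "nat \<Rightarrow> 'a algorithm"
  | Compare nat 'a 'a "bool \<Rightarrow> 'a algorithm"

text \<open>
  Only agents already returned by the oracle (the set \<open>S\<close>) may be asked, and only about
  alternatives in \<open>A\<close>.
\<close>

primrec legal :: "'a set \<Rightarrow> 'a algorithm \<Rightarrow> nat set \<Rightarrow> bool" where
  "legal A (Output b) = (\<lambda>S. True)"
| "legal A (Toss p) = (\<lambda>S. \<forall>f\<in>set_pmf (map_pmf (legal A) p). f S)"
| "legal A (Sample k) = (\<lambda>S. \<forall>i. legal A (k i) (insert i S))"
| "legal A (Compare i x y k) =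
     (\<lambda>S. i \<in> S \<and> x \<in> A \<and> y \<in> A \<and> (\<forall>b. legal A (k b) S))"

primrec run :: "nat \<Rightarrow> (nat \<Rightarrow> 'a rel) \<Rightarrow> 'a algorithm \<Rightarrow> bool pmf" where
  "run n P (Output b) = return_pmf b"
| "run n P (Toss p) = join_pmf (map_pmf (run n P) p)"
| "run n P (Sample k) = bind_pmf (pmf_of_set {..<n}) (\<lambda>i. run n P (k i))"
| "run n P (Compare i x y k) = run n P (k ((x, y) \<in> P i))"

text \<open>The number of comparison queries on a worst-case branch.\<close>

primrec sample_complexity :: "'a algorithm \<Rightarrow> enat" where
  "sample_complexity (Output b) = 0"
| "sample_complexity (Toss p) = Sup (set_pmf (map_pmf sample_complexity p))"
| "sample_complexity (Sample k) = (SUP i. sample_complexity (k i))"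
| "sample_complexity (Compare i x y k) = 1 + (SUP b. sample_complexity (k b))"


section \<open>Random Outliers vs Random Profile\<close>

text \<open>
  The preferences of the agents in \<open>W\<close> are those of \<open>P\<close>; the other ones are independent and
  uniform. For \<open>W = {}\<close> this is the uniformly random profile.
\<close>

definition random_outliers :: 
    "'a set \<Rightarrow> nat \<Rightarrow> nat set \<Rightarrow> (nat \<Rightarrow> 'a rel) \<Rightarrow> (nat \<Rightarrow> 'a rel) pmf" where
  "random_outliers A n W P =
     Pi_pmf {..<n} {} (\<lambda>i. if i \<in> W then return_pmf (P i) else pmf_of_set (prefs A))"

definition random_profile :: "'a set \<Rightarrow> nat \<Rightarrow> (nat \<Rightarrow> 'a rel) pmf" where
  "random_profile A n = Pi_pmf {..<n} {} (\<lambda>_. pmf_of_set (prefs A))"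

definition tester ::
    "real \<Rightarrow> real \<Rightarrow> 'a rel set set \<Rightarrow> 'a set \<Rightarrow> nat \<Rightarrow> 'a algorithm \<Rightarrow> bool" where
  "tester \<epsilon> \<delta> D A n T \<longleftrightarrow>
     legal A T {} \<and>
     (\<forall>W P. W \<subseteq> {..<n} \<longrightarrow> real (card W) \<ge> (1 - \<epsilon>) * real n \<longrightarrow>
        profile_over A W P \<longrightarrow> belongs D W P \<longrightarrow>
        pmf (bind_pmf (random_outliers A n W P) (\<lambda>Q. run n Q T)) False \<le> \<delta>) \<and>
     pmf (bind_pmf (random_profile A n) (\<lambda>Q. run n Q T)) True \<le> \<delta>"

end

theory Submission
  imports Defs "HOL-Probability.Hoeffding" "HOL-Combinatorics.Permutations"
begin

text \<open>
  If \<open>X\<close> is a set of \<open>m0 D\<close> alternatives, then by normality the non-random agents of a profile of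
  kind (i) avoid at least one of the \<open>M = m0!\<close> orders of \<open>X\<close>, so this order occurs with expected
  frequency at most \<open>\<epsilon> / M\<close>, whereas in a random profile every order of \<open>X\<close> has expected frequency
  \<open>1 / M\<close>. The tester determines the order of \<open>X\<close> for sampled agents and decides by comparing the
  least frequency of an order with the midpoint \<open>1 / M - (1 - \<epsilon>) / (2 * M)\<close>. Below \<open>m0 D\<close>, some
  member of the domain contains all preferences over \<open>A\<close>, so that every profile, in particular a
  random one, is also of kind (i).
\<close>

section \<open>Linear orders on a finite set\<close>

lemma prefs_subset: "r \<in> prefs A \<Longrightarrow> r \<subseteq> A \<times> A"
  by (auto simp: prefs_def linear_order_on_def partial_order_on_def preorder_on_def)

lemma rename_iff:
  assumes "inj_on \<sigma> A" "r \<subseteq> A \<times> A" "x \<in> A" "y \<in> A"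
  shows "(\<sigma> x, \<sigma> y) \<in> rename \<sigma> r \<longleftrightarrow> (x, y) \<in> r"
proof
  assume "(\<sigma> x, \<sigma> y) \<in> rename \<sigma> r"
  then obtain a b where "(a, b) \<in> r" "\<sigma> a = \<sigma> x" "\<sigma> b = \<sigma> y"
    unfolding rename_def by auto
  with assms show "(x, y) \<in> r"
    by (metis SigmaD1 SigmaD2 inj_on_eq_iff subsetD)
qed (auto simp: rename_def)

lemma rename_prefs:
  assumes "bij_betw \<sigma> A B" "r \<in> prefs A"
  shows "rename \<sigma> r \<in> prefs B"
proof -
  have r: "r \<subseteq> A \<times> A" "refl_on A r" "trans r" "antisym r" "total_on A r"
    using assms(2) by (auto simp: prefs_def linear_order_on_def partial_order_on_def preorder_on_def)
  have inj: "inj_on \<sigma> A" and B: "B = \<sigma> ` A"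
    using assms(1) by (auto simp: bij_betw_def)
  note mem = rename_iff[OF inj r(1)]
  have sub: "rename \<sigma> r \<subseteq> B \<times> B"
    using r(1) by (auto simp: rename_def B)
  have "refl_on B (rename \<sigma> r)"
    using r(2) mem by (auto simp: refl_on_def B)
  moreover have "trans (rename \<sigma> r)"
  proof (rule transI)
    fix a b c assume *: "(a, b) \<in> rename \<sigma> r" "(b, c) \<in> rename \<sigma> r"
    then obtain x y z where "a = \<sigma> x" "b = \<sigma> y" "c = \<sigma> z" "x \<in> A" "y \<in> A" "z \<in> A"
      using sub B by blast
    with * show "(a, c) \<in> rename \<sigma> r"
      using mem transD[OF r(3)] by blast
  qed
  moreover have "antisym (rename \<sigma> r)"
  proof (rule antisymI)
    fix a b assume *: "(a, b) \<in> rename \<sigma> r" "(b, a) \<in> rename \<sigma> r"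
    then obtain x y where "a = \<sigma> x" "b = \<sigma> y" "x \<in> A" "y \<in> A"
      using sub B by blast
    with * show "a = b"
      using mem antisymD[OF r(4)] by blast
  qed
  moreover have "total_on B (rename \<sigma> r)"
    using r(5) mem by (auto simp: total_on_def B)
  ultimately show ?thesis
    using sub by (simp add: prefs_def linear_order_on_def partial_order_on_def preorder_on_def)
qed

lemma Restr_prefs:
  assumes "X \<subseteq> A" "r \<in> prefs A"
  shows "Restr r X \<in> prefs X"
  using assms unfolding prefs_def linear_order_on_def partial_order_on_def preorder_on_def
  by (auto simp: refl_on_def total_on_def antisym_def trans_def; blast)

lemma finite_prefs: "finite A \<Longrightarrow> finite (prefs A)"
  by (rule finite_subset[of _ "Pow (A \<times> A)"]) (auto dest: prefs_subset)

text \<open>Linear orders of a finite set are well-orders, two well-orders of the same finite set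
  are isomorphic, and the isomorphism is unique. A bijection of \<open>A\<close> renames
  \<open>r\<close> to \<open>s\<close> exactly if it is such an isomorphism.\<close>

lemma ex1_permutes_rename:
  assumes A: "finite A" and r: "r \<in> prefs A" and s: "s \<in> prefs A"
  shows "\<exists>!\<sigma>. \<sigma> permutes A \<and> rename \<sigma> r = s"
proof -
  have wo': "well_order_on A r" "well_order_on A s"
    using r s A linear_order_on_well_order_on finite_subset[OF prefs_subset[OF r]]
      finite_subset[OF prefs_subset[OF s]] by (auto simp: prefs_def)
  have wo: "Well_order r" "Field r = A" "Well_order s" "Field s = A"
    using well_order_on_Well_order[OF wo'(1)] well_order_on_Well_order[OF wo'(2)] by auto
  have rs: "r \<subseteq> A \<times> A" "s \<subseteq> A \<times> A"
    using r s by (auto dest: prefs_subset)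
  have iso: "iso r s \<sigma> \<longleftrightarrow> rename \<sigma> r = s" if \<sigma>: "bij_betw \<sigma> A A" for \<sigma>
  proof -
    have inj: "inj_on \<sigma> A" and B: "\<sigma> ` A = A"
      using \<sigma> by (auto simp: bij_betw_def)
    note mem = rename_iff[OF inj rs(1)]
    have sub: "rename \<sigma> r \<subseteq> A \<times> A"
      using prefs_subset[OF rename_prefs[OF \<sigma> r]] .
    have "rename \<sigma> r = s \<longleftrightarrow> (\<forall>a\<in>\<sigma> ` A. \<forall>b\<in>\<sigma> ` A. (a, b) \<in> rename \<sigma> r \<longleftrightarrow> (a, b) \<in> s)"
      unfolding B using sub rs(2) by auto
    also have "\<dots> \<longleftrightarrow> (\<forall>x\<in>A. \<forall>y\<in>A. (x, y) \<in> r \<longleftrightarrow> (\<sigma> x, \<sigma> y) \<in> s)"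
      using mem by auto
    finally show ?thesis
      using \<sigma> wo by (simp add: iso_iff2)
  qed
  obtain f where f: "iso r s f"
    using finite_well_order_on_ordIso[OF A wo'] by (auto simp: ordIso_def)
  hence bf: "bij_betw f A A" using wo by (auto simp: iso_iff2)
  \<comment> \<open>An isomorphism is determined only on the field \<open>A\<close>; taking the
    identity outside makes it a permutation and extends uniqueness to all arguments.\<close>
  define \<sigma> where "\<sigma> = (\<lambda>x. if x \<in> A then f x else x)"
  have \<sigma>: "bij_betw \<sigma> A A"
    using bf by (rule bij_betw_cong[THEN iffD1, rotated]) (simp add: \<sigma>_def)
  have perm: "\<sigma> permutes A"
    using \<sigma> by (rule bij_imp_permutes) (simp add: \<sigma>_def)
  have "iso r s \<sigma>"
    using f \<sigma> wo(2,4) by (simp add: iso_iff2, simp add: \<sigma>_def)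
  show ?thesis
  proof (rule ex1I[of _ \<sigma>])
    show "\<sigma> permutes A \<and> rename \<sigma> r = s"
      using perm iso[OF \<sigma>] \<open>iso r s \<sigma>\<close> by simp
    fix \<tau> assume \<tau>: "\<tau> permutes A \<and> rename \<tau> r = s"
    hence "iso r s \<tau>"
      using iso permutes_imp_bij by blast
    hence "\<tau> x = \<sigma> x" if "x \<in> A" for x
      using embed_unique[of r s \<tau> \<sigma> x] wo \<open>iso r s \<sigma>\<close> that by (auto simp: iso_def)
    thus "\<tau> = \<sigma>"
      using \<tau> by (auto simp: fun_eq_iff \<sigma>_def permutes_def)
  qed
qed

lemma prefs_nonempty:
  assumes "finite A"
  shows "prefs A \<noteq> {}"
proof -
  obtain r where "well_order_on A r"
    using well_order_on by blast
  thus ?thesis by (auto simp: prefs_def well_order_on_def)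
qed

text \<open>For a fixed order \<open>r\<close>, every order is the renaming of \<open>r\<close> by
  exactly one permutation of \<open>A\<close>, so orders are as many as permutations.\<close>

lemma card_prefs:
  assumes A: "finite A"
  shows "card (prefs A) = fact (card A)"
proof -
  obtain r where r: "r \<in> prefs A"
    using prefs_nonempty[OF A] by blast
  have "bij_betw (\<lambda>\<sigma>. rename \<sigma> r) {\<sigma>. \<sigma> permutes A} (prefs A)"
  proof (rule bij_betwI')
    fix \<sigma> \<tau> assume "\<sigma> \<in> {\<sigma>. \<sigma> permutes A}" "\<tau> \<in> {\<sigma>. \<sigma> permutes A}"
    thus "(rename \<sigma> r = rename \<tau> r) = (\<sigma> = \<tau>)"
      using ex1_permutes_rename[OF A r] rename_prefs[OF permutes_imp_bij r] by blast
  qed (use ex1_permutes_rename[OF A r] rename_prefs[OF permutes_imp_bij r] in blast)+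
  thus ?thesis
    using card_permutations[OF refl A] bij_betw_same_card by force
qed

lemma Restr_rename:
  assumes "bij \<sigma>" "\<sigma> ` X = X"
  shows "Restr (rename \<sigma> r) X = rename \<sigma> (Restr r X)"
  using assms unfolding rename_def bij_def inj_def by auto

lemma rename_inv:
  assumes "bij \<sigma>" 
  shows "rename \<sigma> (rename (inv \<sigma>) r) = r" "rename (inv \<sigma>) (rename \<sigma> r) = r"
proof -
  have "\<And>x. \<sigma> (inv \<sigma> x) = x" "\<And>x. inv \<sigma> (\<sigma> x) = x"
    using assms by (auto simp: bij_def surj_f_inv_f)
  thus "rename \<sigma> (rename (inv \<sigma>) r) = r" "rename (inv \<sigma>) (rename \<sigma> r) = r"
    by (auto simp: rename_def image_image map_prod_def split_beta)
qed

text \<open>The permutations of \<open>X\<close> act transitively on \<open>prefs X\<close>, so all fibres of the restriction have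
  the same size.\<close>

lemma pmf_map_Restr_prefs:
  assumes A: "finite A" and X: "X \<subseteq> A" and s: "s \<in> prefs X"
  shows "pmf (map_pmf (\<lambda>r. Restr r X) (pmf_of_set (prefs A))) s = 1 / fact (card X)"
proof -
  define p where "p = map_pmf (\<lambda>r. Restr r X) (pmf_of_set (prefs A))"
  have fX: "finite X" using A X finite_subset by blast
  have eq: "pmf p t = pmf p s" if t: "t \<in> prefs X" for t
  proof -
    obtain \<sigma> where \<sigma>: "\<sigma> permutes X" "rename \<sigma> s = t"
      using ex1_permutes_rename[OF fX s t] by blast
    have \<sigma>A: "\<sigma> permutes A" using \<sigma>(1) X permutes_subset by blast
    have bij: "bij \<sigma>" using \<sigma>(1) by (rule permutes_bij)
    have inv: "inv \<sigma> permutes A" using \<sigma>A by (rule permutes_inv)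
    have bb: "bij_betw (rename \<sigma>) (prefs A) (prefs A)"
      by (rule bij_betw_byWitness[where f' = "rename (inv \<sigma>)"])
         (use rename_inv[OF bij] rename_prefs[OF permutes_imp_bij[OF \<sigma>A]] rename_prefs[OF permutes_imp_bij[OF inv]] in auto)
    have "inj (rename \<sigma>)" by (metis bij injI rename_inv(2))
    \<comment> \<open>Renaming by \<open>\<sigma>\<close> preserves the uniform distribution on
      \<open>prefs A\<close>, and it commutes with the restriction to \<open>X\<close> because
      \<open>\<sigma>\<close> maps \<open>X\<close> onto itself. Hence \<open>p\<close> is invariant
      under \<open>\<sigma>\<close>.\<close>
    have "p = map_pmf (\<lambda>r. Restr r X) (map_pmf (rename \<sigma>) (pmf_of_set (prefs A)))"
      using map_pmf_of_set_bij_betw[OF bb prefs_nonempty[OF A] finite_prefs[OF A]] by (simp add: p_def)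
    also have "\<dots> = map_pmf (rename \<sigma>) p"
      by (simp add: p_def map_pmf_comp Restr_rename[OF bij permutes_image[OF \<sigma>(1)]])
    finally have "pmf p t = pmf (map_pmf (rename \<sigma>) p) (rename \<sigma> s)"
      using \<sigma>(2) by simp
    also have "\<dots> = pmf p s"
      using \<open>inj (rename \<sigma>)\<close> by (rule pmf_map_inj')
    finally show ?thesis .
  qed
  have "set_pmf p \<subseteq> prefs X"
    using Restr_prefs[OF X] prefs_nonempty[OF A] finite_prefs[OF A] by (auto simp: p_def)
  hence "1 = (\<Sum>t\<in>prefs X. pmf p t)"
    using sum_pmf_eq_1[OF finite_prefs[OF fX]] by metis
  also have "\<dots> = fact (card X) * pmf p s"
    using eq by (simp add: card_prefs[OF fX])
  finally show ?thesis by (simp add: p_def field_simps)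
qed

section \<open>Reading preferences of sampled agents\<close>

text \<open>The continuation \<open>k\<close> receives the set of pairs that agent \<open>i\<close>
  confirmed. Started from the empty set with \<open>set ps = X \<times> X\<close>, this is the
  restriction of the agent's preference to \<open>X\<close>.\<close>

primrec ask :: "nat \<Rightarrow> ('a \<times> 'a) list \<Rightarrow> 'a rel \<Rightarrow> ('a rel \<Rightarrow> 'a algorithm) \<Rightarrow> 'a algorithm" where
  "ask i [] s k = k s"
| "ask i (p # ps) s k =
     Compare i (fst p) (snd p) (\<lambda>b. ask i ps (if b then insert p s else s) k)"

primrec gather :: "nat \<Rightarrow> ('a \<times> 'a) list \<Rightarrow> ('a rel list \<Rightarrow> bool) \<Rightarrow> 'a algorithm" where
  "gather 0 ps g = Output (g [])"
| "gather (Suc k) ps g = Sample (\<lambda>i. ask i ps {} (\<lambda>s. gather k ps (\<lambda>l. g (s # l))))"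

lemma run_ask: "run n Q (ask i ps s k) = run n Q (k (s \<union> (Q i \<inter> set ps)))"
  by (induction ps arbitrary: s) auto

text \<open>Once the profile is fixed, agents drawn with replacement give independent, identically
  distributed readings, and \<open>g\<close> is applied to the list of them.\<close>

lemma run_gather:
  "run n Q (gather k ps g) =
     map_pmf g (replicate_pmf k (map_pmf (\<lambda>i. Q i \<inter> set ps) (pmf_of_set {..<n})))"
  by (induction k arbitrary: g)
     (simp_all add: run_ask map_pmf_def bind_assoc_pmf bind_return_pmf)

lemma legal_ask:
  assumes "i \<in> S" "set ps \<subseteq> A \<times> A" "\<And>s. legal A (k s) S"
  shows "legal A (ask i ps s k) S"
  using assms by (induction ps arbitrary: s) auto

lemma legal_gather: "set ps \<subseteq> A \<times> A \<Longrightarrow> legal A (gather k ps g) S"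
  by (induction k arbitrary: g S) (auto intro!: legal_ask)

lemma sample_complexity_ask:
  assumes "\<And>s. sample_complexity (k s) \<le> c"
  shows "sample_complexity (ask i ps s k) \<le> enat (length ps) + c"
proof (induction ps arbitrary: s)
  case Nil
  show ?case using assms by (simp add: zero_enat_def[symmetric])
next
  case (Cons p ps)
  have "(SUP b. sample_complexity (ask i ps (if b then insert p s else s) k)) \<le> enat (length ps) + c"
    by (intro SUP_least Cons)
  hence "1 + (SUP b. sample_complexity (ask i ps (if b then insert p s else s) k)) \<le>
      1 + (enat (length ps) + c)"
    by (rule add_left_mono)
  also have "\<dots> = enat (length (p # ps)) + c"
    by (simp add: one_enat_def add.assoc[symmetric])
  finally show ?case by simp
qed

lemma sample_complexity_gather: "sample_complexity (gather k ps g) \<le> enat (k * length ps)"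
proof (induction k arbitrary: g)
  case (Suc k)
  show ?case
    using sample_complexity_ask[where c = "enat (k * length ps)", OF Suc]
    by (auto intro!: SUP_least)
qed (simp add: zero_enat_def)

text \<open>Comparing each entry with \<open>r\<close> turns the list into independent Bernoulli
  trials. This gives access to the binomial tail bounds for the sampling stage.\<close>

lemma map_count_list_replicate_pmf:
  "map_pmf (\<lambda>l. count_list l r) (replicate_pmf k p) = binomial_pmf k (pmf p r)"
proof -
  have b: "bernoulli_pmf (pmf p r) = map_pmf ((=) r) p"
  proof (rule pmf_eqI)
    fix b show "pmf (bernoulli_pmf (pmf p r)) b = pmf (map_pmf ((=) r) p) b"
    proof (cases b)
      case True
      thus ?thesis by (simp add: pmf_map vimage_def pmf_le_1 measure_pmf_single)
    next
      case False
      have "(=) r -` {False} = UNIV - {r}" by auto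
      thus ?thesis
        using False measure_pmf.prob_compl[of "{r}" p] by (simp add: pmf_map pmf_le_1 measure_pmf_single)
    qed
  qed
  have "replicate_pmf k (map_pmf ((=) r) p) = map_pmf (map ((=) r)) (replicate_pmf k p)"
    by (induction k) (simp_all add: map_bind_pmf bind_map_pmf)
  thus ?thesis
    by (simp add: binomial_pmf_altdef pmf_le_1 b map_pmf_comp count_list_eq_length_filter
        filter_map o_def)
qed

section \<open>Concentration of sampled frequencies\<close>

text \<open>Hoeffding's inequality for the indicators of \<open>f i \<in> S\<close>, at deviation
  \<open>n * \<eta>\<close> of their sum. The components may have different distributions, since the
  agents of \<open>W\<close> are deterministic and the outliers uniform.\<close>

lemma Pi_pmf_frequency_concentrated:
  fixes p :: "nat \<Rightarrow> 'b pmf" and n :: nat and S :: "'b set" and \<eta> :: real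
  assumes n: "n > 0" and \<eta>: "\<eta> \<ge> 0"
  defines "\<mu> \<equiv> (\<Sum>i<n. measure_pmf.prob (p i) S) / n"
  shows "measure_pmf.prob (Pi_pmf {..<n} d p) {f. card {i\<in>{..<n}. f i \<in> S} / n \<ge> \<mu> + \<eta>}
           \<le> exp (- 2 * n * \<eta>\<^sup>2)" (is ?ge)
    and "measure_pmf.prob (Pi_pmf {..<n} d p) {f. card {i\<in>{..<n}. f i \<in> S} / n \<le> \<mu> - \<eta>}
           \<le> exp (- 2 * n * \<eta>\<^sup>2)" (is ?le)
proof -
  let ?M = "Pi_pmf {..<n} d p"
  let ?X = "\<lambda>i f. indicator S (f i) :: real"
  have E: "measure_pmf.expectation ?M (?X i) = measure_pmf.prob (p i) S" if "i < n" for i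
  proof -
    have "measure_pmf.expectation ?M (?X i) =
        measure_pmf.expectation (map_pmf (\<lambda>f. f i) ?M) (indicator S)"
      by (simp only: integral_map_pmf)
    also have "map_pmf (\<lambda>f. f i) ?M = p i"
      using that by (simp add: Pi_pmf_component)
    finally show ?thesis by simp
  qed
  interpret Hoeffding_ineq "measure_pmf ?M" "{..<n}" ?X "\<lambda>_. 0" "\<lambda>_. 1" "real n * \<mu>"
  proof unfold_locales
    show "prob_space.indep_vars (measure_pmf ?M) (\<lambda>_. borel) ?X {..<n}"
      by (intro prob_space.indep_vars_compose2[OF _ indep_vars_Pi_pmf])
         (auto simp: measure_pmf.prob_space_axioms)
    show "real n * \<mu> \<equiv> \<Sum>i<n. measure_pmf.expectation ?M (?X i)"
      using n by (simp add: E \<mu>_def)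
  qed (auto simp: indicator_def)
  have card: "(\<Sum>i<n. ?X i f) = card {i\<in>{..<n}. f i \<in> S}" for f
    using sum_indicator_eq_card[of "{..<n}" "{i. f i \<in> S}"]
    by (simp add: indicator_def Int_def of_bool_def conj_commute sum.If_cases)
  have e: "exp (- 2 * (n * \<eta>)\<^sup>2 / (\<Sum>i<n. (1 - 0 :: real)\<^sup>2)) = exp (- 2 * n * \<eta>\<^sup>2)"
    using n by (simp add: power2_eq_square)
  have pos: "(\<Sum>i<n. (1 - 0 :: real)\<^sup>2) > 0" and n\<eta>: "0 \<le> n * \<eta>"
    using n \<eta> by simp_all
  show ?ge
    using Hoeffding_ineq_ge[OF n\<eta> pos] n unfolding card e
    by (simp add: field_simps)
  show ?le
    using Hoeffding_ineq_le[OF n\<eta> pos] n unfolding card e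
    by (simp add: field_simps)
qed

text \<open>By total probability: on the exceptional set \<open>B\<close> the second-stage
  probability is bounded by 1, elsewhere by \<open>c\<close>.\<close>

lemma prob_bind_pmf_le:
  assumes "\<And>x. x \<in> set_pmf M \<Longrightarrow> x \<notin> B \<Longrightarrow> measure_pmf.prob (f x) S \<le> c" "c \<ge> 0"
  shows "measure_pmf.prob (bind_pmf M f) S \<le> measure_pmf.prob M B + c"
proof -
  have int: "integrable M (indicator B :: _ \<Rightarrow> real)"
    by (rule measure_pmf.integrable_const_bound[where B = 1]) (auto simp: indicator_def)
  have "measure_pmf.prob (bind_pmf M f) S = measure_pmf.expectation M (\<lambda>x. measure_pmf.prob (f x) S)"
    unfolding measure_pmf_bind
    by (subst measure_pmf.measure_bind[where N = "count_space UNIV"]) 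
       (auto simp: measurable_def measure_pmf_in_subprob_algebra)
  also have "\<dots> \<le> measure_pmf.expectation M (\<lambda>x. indicator B x + c)"
  proof (rule integral_mono_AE)
    show "integrable M (\<lambda>x. measure_pmf.prob (f x) S)"
      by (rule measure_pmf.integrable_const_bound[where B = 1]) auto
    show "integrable M (\<lambda>x. indicator B x + c)"
      by (intro Bochner_Integration.integrable_add int measure_pmf.integrable_const)
    show "AE x in measure_pmf M. measure_pmf.prob (f x) S \<le> indicator B x + c"
      using assms by (auto simp: AE_measure_pmf_iff indicator_def intro: add_increasing2)
  qed
  also have "\<dots> = measure_pmf.prob M B + c"
    by (subst Bochner_Integration.integral_add[OF int]) simp_all
  finally show ?thesis .
qed

text \<open>Sampling with replacement from a random population: the frequency in the population
  concentrates around its mean and the frequency in the sample around that of the population.\<close>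

lemma sample_frequency_concentrated:
  fixes p :: "nat \<Rightarrow> 'b pmf" and n k :: nat and g :: "'b \<Rightarrow> 'c" and r :: 'c and d :: 'b and \<eta> :: real
  assumes n: "n > 0" and k: "k > 0" and \<eta>: "\<eta> \<ge> 0"
  defines "\<mu> \<equiv> (\<Sum>i<n. pmf (map_pmf g (p i)) r) / n"
  defines "L \<equiv> bind_pmf (Pi_pmf {..<n} d p)
                 (\<lambda>f. replicate_pmf k (map_pmf (\<lambda>i. g (f i)) (pmf_of_set {..<n})))"
  shows "measure_pmf.prob L {l. count_list l r / k \<ge> \<mu> + 2 * \<eta>}
           \<le> exp (- 2 * n * \<eta>\<^sup>2) + exp (- 2 * k * \<eta>\<^sup>2)" (is ?ge)
    and "measure_pmf.prob L {l. count_list l r / k \<le> \<mu> - 2 * \<eta>}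
           \<le> exp (- 2 * n * \<eta>\<^sup>2) + exp (- 2 * k * \<eta>\<^sup>2)" (is ?le)
proof -
  let ?S = "g -` {r}"
  define q where "q f = card {i\<in>{..<n}. f i \<in> ?S} / n" for f
  have \<mu>: "\<mu> = (\<Sum>i<n. measure_pmf.prob (p i) ?S) / n"
    by (simp add: \<mu>_def pmf_map)
  have q: "pmf (map_pmf (\<lambda>i. g (f i)) (pmf_of_set {..<n})) r = q f" for f
  proof -
    have "{..<n} \<inter> (\<lambda>i. g (f i)) -` {r} = {i\<in>{..<n}. f i \<in> ?S}" by auto
    thus ?thesis using n by (simp add: pmf_map measure_pmf_of_set q_def lessThan_empty_iff)
  qed
  have q01: "binomial_distribution (q f)" for f
    by unfold_locales (simp add: q[symmetric] pmf_le_1)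
  have bin: "measure_pmf.prob (replicate_pmf k (map_pmf (\<lambda>i. g (f i)) (pmf_of_set {..<n})))
      {l. R (count_list l r)} = measure_pmf.prob (binomial_pmf k (q f)) {x. R x}" for f R
    by (subst q[symmetric], subst map_count_list_replicate_pmf[symmetric]) (simp add: vimage_def)
  have "measure_pmf.prob L {l. count_list l r / k \<ge> \<mu> + 2 * \<eta>}
      \<le> measure_pmf.prob (Pi_pmf {..<n} d p) {f. q f \<ge> \<mu> + \<eta>} + exp (- 2 * k * \<eta>\<^sup>2)"
    unfolding L_def
  proof (rule prob_bind_pmf_le)
    \<comment> \<open>If the population frequency \<open>q f\<close> is within \<open>\<eta>\<close>
      above the mean, a sample frequency \<open>2 * \<eta>\<close> above the mean exceeds
      \<open>q f\<close> by at least \<open>\<eta>\<close>, which the binomial tail bounds. The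
      lower tail below is symmetric.\<close>
    fix f assume "f \<notin> {f. q f \<ge> \<mu> + \<eta>}"
    hence "{x::nat. x / k \<ge> \<mu> + 2 * \<eta>} \<subseteq> {x. x / k \<ge> q f + \<eta>}"
      by auto
    from order.trans[OF measure_pmf.finite_measure_mono[OF this]
        binomial_distribution.prob_ge'[OF q01 k \<eta>]]
    show "measure_pmf.prob (replicate_pmf k (map_pmf (\<lambda>i. g (f i)) (pmf_of_set {..<n})))
        {l. count_list l r / k \<ge> \<mu> + 2 * \<eta>} \<le> exp (- 2 * k * \<eta>\<^sup>2)"
      by (simp add: bin[where R = "\<lambda>x. x / k \<ge> \<mu> + 2 * \<eta>"])
  qed simp
  with Pi_pmf_frequency_concentrated(1)[OF n \<eta>, where S = ?S and p = p and d = d] show ?ge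
    unfolding \<mu>[symmetric] q_def by linarith
  have "measure_pmf.prob L {l. count_list l r / k \<le> \<mu> - 2 * \<eta>}
      \<le> measure_pmf.prob (Pi_pmf {..<n} d p) {f. q f \<le> \<mu> - \<eta>} + exp (- 2 * k * \<eta>\<^sup>2)"
    unfolding L_def
  proof (rule prob_bind_pmf_le)
    fix f assume "f \<notin> {f. q f \<le> \<mu> - \<eta>}"
    hence "{x::nat. x / k \<le> \<mu> - 2 * \<eta>} \<subseteq> {x. x / k \<le> q f - \<eta>}"
      by auto
    from order.trans[OF measure_pmf.finite_measure_mono[OF this]
        binomial_distribution.prob_le'[OF q01 k \<eta>]]
    show "measure_pmf.prob (replicate_pmf k (map_pmf (\<lambda>i. g (f i)) (pmf_of_set {..<n})))
        {l. count_list l r / k \<le> \<mu> - 2 * \<eta>} \<le> exp (- 2 * k * \<eta>\<^sup>2)"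
      by (simp add: bin[where R = "\<lambda>x. x / k \<le> \<mu> - 2 * \<eta>"])
  qed simp
  with Pi_pmf_frequency_concentrated(2)[OF n \<eta>, where S = ?S and p = p and d = d] show ?le
    unfolding \<mu>[symmetric] q_def by linarith
qed

section \<open>Content of a domain\<close>

definition pref_counts :: "'a rel set set \<Rightarrow> nat \<Rightarrow> nat set" where
  "pref_counts D m = {card (P ` {..<n}) | A n P. finite A \<and> card A = m \<and>
     profile_over A {..<n} P \<and> belongs D {..<n} P}"

lemma con_eq: "m \<noteq> 1 \<Longrightarrow> con D m = real (Max (pref_counts D m)) / fact m"
  by (simp add: con_def pref_counts_def)

lemma finite_pref_counts: "finite (pref_counts D m)"
proof (rule finite_subset)
  have "card (P ` {..<n}) \<le> fact m"
    if "finite A" "card A = m" "profile_over A {..<n} P"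
    for A :: "'a set" and n and P :: "nat \<Rightarrow> 'a rel"
    using card_mono[OF finite_prefs[OF that(1)], of "P ` {..<n}"] that
    by (auto simp: card_prefs profile_over_def)
  thus "pref_counts D m \<subseteq> {..fact m}" by (auto simp: pref_counts_def)
qed simp

lemma card_in_pref_counts:
  assumes "finite A" "profile_over A {..<n} P" "belongs D {..<n} P"
  shows "card (P ` {..<n}) \<in> pref_counts D (card A)"
  using assms by (auto simp: pref_counts_def)

lemma con_ge:
  assumes "finite A" "card A \<noteq> 1" "profile_over A {..<n} P" "belongs D {..<n} P"
  shows "card (P ` {..<n}) / fact (card A) \<le> con D (card A)"
proof -
  have "card (P ` {..<n}) \<le> Max (pref_counts D (card A))"
    using card_in_pref_counts[OF assms(1,3,4)] by (rule Max_ge[OF finite_pref_counts])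
  thus ?thesis using assms(2) by (simp add: con_eq divide_right_mono)
qed

text \<open>By normality the restrictions to \<open>X\<close> form a profile of the domain over
  \<open>X\<close>. A content below 1 then leaves fewer than \<open>fact (card X)\<close> distinct
  restrictions.\<close>

lemma ex_missing_pref:
  assumes D: "normal_domain D" and A: "finite A" and X: "X \<subseteq> A" "X \<noteq> {}"
    and con: "con D (card X) < 1"
    and W: "finite W" and P: "profile_over A W P" "belongs D W P"
  obtains r where "r \<in> prefs X" "\<And>i. i \<in> W \<Longrightarrow> Restr (P i) X \<noteq> r"
proof -
  have fX: "finite X" using X A finite_subset by blast
  \<comment> \<open>Normality and content speak of profiles indexed by \<open>{..<n}\<close>, so the
    agents of \<open>W\<close> are renumbered.\<close>
  obtain f where f: "bij_betw f {..<card W} W"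
    using ex_bij_betw_nat_finite[OF W] by (auto simp: lessThan_atLeast0)
  hence fW: "f ` {..<card W} = W" by (simp add: bij_betw_def)
  define Q where "Q = (\<lambda>i. Restr (P (f i)) X)"
  have "profile_over A {..<card W} (\<lambda>i. P (f i))" "belongs D {..<card W} (\<lambda>i. P (f i))"
    using P fW by (auto simp: profile_over_def belongs_def)
  hence "belongs D {..<card W} Q"
    using D A X unfolding normal_domain_def Q_def by blast
  moreover have "profile_over X {..<card W} Q"
    using P(1) fW Restr_prefs[OF X(1)] by (auto simp: profile_over_def Q_def)
  moreover have "card X \<noteq> 1" using con by (auto simp: con_def)
  ultimately have "card (Q ` {..<card W}) / fact (card X) \<le> con D (card X)"
    using con_ge[OF fX] by blast
  with con have "card (Q ` {..<card W}) / fact (card X) < 1" by linarith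
  hence "real (card (Q ` {..<card W})) < real (card (prefs X))"
    by (simp add: card_prefs[OF fX])
  hence "\<not> prefs X \<subseteq> Q ` {..<card W}"
    using card_mono[of "Q ` {..<card W}" "prefs X"] by auto
  then obtain r where r: "r \<in> prefs X" "r \<notin> Q ` {..<card W}" by blast
  have "Restr (P i) X \<noteq> r" if "i \<in> W" for i
  proof -
    obtain j where "j < card W" "i = f j"
      using \<open>i \<in> W\<close> fW by (metis imageE lessThan_iff)
    thus ?thesis using r(2) unfolding Q_def by blast
  qed
  with r(1) show ?thesis by (rule that)
qed

text \<open>Neutrality speaks of permutations of the whole universe. Since \<open>A\<close> and
  \<open>B\<close> have complements of equal size in their union, a bijection between them extends
  to a permutation of the union and then by the identity.\<close>

lemma ex_bij_image_eq:
  fixes A B :: "'a set"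
  assumes "finite A" "finite B" "card A = card B"
  obtains \<sigma> where "bij \<sigma>" "\<sigma> ` A = B"
proof -
  let ?U = "A \<union> B"
  have "card (?U - A) = card (?U - B)"
    using assms by (simp add: card_Diff_subset)
  then obtain f g where f: "bij_betw f A B" and g: "bij_betw g (?U - A) (?U - B)"
    using assms by (metis finite_Diff finite_UnI finite_same_card_bij)
  define \<sigma> where "\<sigma> x = (if x \<in> A then f x else if x \<in> B then g x else x)" for x
  have "bij_betw \<sigma> A B"
    using f by (rule bij_betw_cong[THEN iffD1, rotated]) (simp add: \<sigma>_def)
  moreover have "bij_betw \<sigma> (?U - A) (?U - B)"
    using g by (rule bij_betw_cong[THEN iffD1, rotated]) (auto simp: \<sigma>_def)
  ultimately have "bij_betw \<sigma> (A \<union> (?U - A)) (B \<union> (?U - B))"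
    by (rule bij_betw_combine) auto
  moreover have "A \<union> (?U - A) = ?U" "B \<union> (?U - B) = ?U" by auto
  ultimately have "bij_betw \<sigma> ?U ?U" by simp
  hence "\<sigma> permutes ?U" by (rule bij_imp_permutes) (simp add: \<sigma>_def)
  thus ?thesis
    using that \<open>bij_betw \<sigma> A B\<close> permutes_bij bij_betw_imp_surj_on by blast
qed

text \<open>For more than one alternative the maximum in the content is attained, and a profile with
  \<open>fact (card A)\<close> distinct preferences exhausts all of them. For one alternative the
  content is 1 by convention only, so the witness is built by restricting some preference of the
  domain to a singleton.\<close>

lemma con_ge_1_witness:
  fixes D :: "'a rel set set" and A :: "'a set"
  assumes D: "is_domain D" "\<Union>D \<noteq> {}" "normal_domain D"
    and A: "finite A" "A \<noteq> {}" and con: "con D (card A) \<ge> 1"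
  obtains A' n P where "finite A'" "card A' = card A" "profile_over A' {..<n} P"
    "belongs D {..<n} P" "P ` {..<n} = prefs A'"
proof -
  obtain A' n P where *: "finite A'" "card A' = card A" "profile_over A' {..<n} P"
    "belongs D {..<n} P" "card (P ` {..<n}) \<ge> fact (card A)"
  proof (cases "card A = 1")
    case True
    obtain B r where B: "B \<in> D" "r \<in> B" using D(2) by blast
    then obtain A'' where A'': "finite A''" "A'' \<noteq> {}" "r \<in> prefs A''"
      using D(1) unfolding is_domain_def by blast
    then obtain x where x: "x \<in> A''" by blast
    have "profile_over A'' {..<1} (\<lambda>_. r)" "belongs D {..<1} (\<lambda>_. r)"
      using A'' B by (auto simp: profile_over_def belongs_def)
    moreover have "{x} \<subseteq> A''" "{x} \<noteq> {}" using x by auto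
    ultimately have "belongs D {..<1} (\<lambda>_. Restr r {x})"
      using D(3) A''(1) unfolding normal_domain_def by blast
    moreover have "profile_over {x} {..<1} (\<lambda>_. Restr r {x})"
      using Restr_prefs[OF \<open>{x} \<subseteq> A''\<close> A''(3)] by (simp add: profile_over_def)
    ultimately show ?thesis
      using True by (intro that[of "{x}" 1 "\<lambda>_. Restr r {x}"]) (auto simp: lessThan_Suc)
  next
    case False
    let ?S = "pref_counts D (card A)"
    \<comment> \<open>The empty profile shows that the maximum is taken over a nonempty set.\<close>
    obtain B where "B \<in> D" using D(2) by blast
    hence "belongs D {..<0} (\<lambda>_. {})" "profile_over A {..<0} (\<lambda>_. {})"
      by (auto simp: belongs_def profile_over_def)
    hence "?S \<noteq> {}" using card_in_pref_counts[OF A(1)] by blast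
    hence "Max ?S \<in> ?S" by (rule Max_in[OF finite_pref_counts])
    then obtain A' n P where *: "finite A'" "card A' = card A" "profile_over A' {..<n} P"
      "belongs D {..<n} P" "Max ?S = card (P ` {..<n})"
      unfolding pref_counts_def by blast
    have "real (Max ?S) \<ge> real (fact (card A))"
      using con False by (simp add: con_eq field_simps)
    hence "card (P ` {..<n}) \<ge> fact (card A)" unfolding *(5) of_nat_le_iff .
    with *(1-4) show ?thesis by (rule that)
  qed
  moreover have "P ` {..<n} = prefs A'"
    by (rule card_seteq) (use * in \<open>auto simp: finite_prefs card_prefs profile_over_def\<close>)
  ultimately show ?thesis using that by blast
qed

text \<open>The exhausting profile may live on another set \<open>A'\<close> of the same size.
  Neutrality moves it to \<open>A\<close>, and each order \<open>s\<close> of \<open>A\<close> is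
  reached as the renaming of \<open>rename (inv \<sigma>) s\<close>.\<close>

lemma prefs_subset_domain:
  assumes D: "is_domain D" "\<Union>D \<noteq> {}" "normal_domain D" "neutral_domain D"
    and A: "finite A" "A \<noteq> {}" and con: "con D (card A) \<ge> 1"
  obtains B where "B \<in> D" "prefs A \<subseteq> B"
proof -
  obtain A' n P where P: "finite A'" "card A' = card A" "profile_over A' {..<n} P"
    "belongs D {..<n} P" "P ` {..<n} = prefs A'"
    using con_ge_1_witness[OF D(1-3) A con] .
  obtain \<sigma> where \<sigma>: "bij \<sigma>" "\<sigma> ` A' = A"
    using ex_bij_image_eq[OF P(1) A(1) P(2)] .
  have "A' \<noteq> {}" using A P(1,2) by auto
  hence "belongs D {..<n} (\<lambda>i. rename \<sigma> (P i))"
    using D(4) P \<sigma>(1) unfolding neutral_domain_def by blast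
  then obtain B where B: "B \<in> D" "\<And>i. i < n \<Longrightarrow> rename \<sigma> (P i) \<in> B"
    by (auto simp: belongs_def)
  have "inv \<sigma> ` A = A'"
    using \<sigma>(2) image_inv_f_f[OF bij_is_inj[OF \<sigma>(1)], of A'] by simp
  hence "bij_betw (inv \<sigma>) A A'"
    using bij_imp_bij_inv[OF \<sigma>(1)] by (metis bij_betw_def inj_on_subset subset_UNIV)
  hence "rename (inv \<sigma>) s \<in> P ` {..<n}" if "s \<in> prefs A" for s
    using rename_prefs that P(5) by blast
  hence "s \<in> B" if "s \<in> prefs A" for s
    using that B(2) rename_inv(1)[OF \<sigma>(1), of s] by force
  thus ?thesis using that B(1) by blast
qed

section \<open>Testers above and below the threshold\<close>

text \<open>Every outcome \<open>Q\<close> of the random profile is also an instance of kind (i),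
  with all agents in \<open>W\<close> and no outliers. Averaging over \<open>Q\<close>, a tester
  would give each verdict with probability at most \<open>\<delta>\<close> on the random profile,
  although these sum to 1 and \<open>2 * \<delta> < 1\<close>.\<close>

lemma not_tester:
  assumes A: "finite A" and B: "B \<in> D" "prefs A \<subseteq> B"
    and \<epsilon>: "0 \<le> \<epsilon>" and \<delta>: "0 \<le> \<delta>" "\<delta> < 1 / 2"
  shows "\<not> tester \<epsilon> \<delta> D A n T"
proof
  assume T: "tester \<epsilon> \<delta> D A n T"
  let ?p = "bind_pmf (random_profile A n) (\<lambda>Q. run n Q T)"
  have "pmf (run n Q T) False \<le> \<delta>" if "Q \<in> set_pmf (random_profile A n)" for Q
  proof -
    \<comment> \<open>Outside \<open>{..<n}\<close> both product distributions take the default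
      value \<open>{}\<close>, so the instance without outliers is the point mass at
      \<open>Q\<close> itself.\<close>
    have Q: "\<And>i. i < n \<Longrightarrow> Q i \<in> prefs A" "\<And>i. i \<notin> {..<n} \<Longrightarrow> Q i = {}"
      using that prefs_nonempty[OF A] finite_prefs[OF A]
      by (auto simp: random_profile_def set_Pi_pmf PiE_dflt_def)
    have "random_outliers A n {..<n} Q = Pi_pmf {..<n} {} (\<lambda>i. return_pmf (Q i))"
      unfolding random_outliers_def by (rule Pi_pmf_cong) auto
    also have "\<dots> = return_pmf Q"
      using Q(2) by (subst Pi_pmf_return_pmf) (auto simp: fun_eq_iff)
    finally have "random_outliers A n {..<n} Q = return_pmf Q" .
    moreover have "profile_over A {..<n} Q" "belongs D {..<n} Q"
      using Q(1) B unfolding profile_over_def belongs_def by blast+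
    moreover have "real (card {..<n}) \<ge> (1 - \<epsilon>) * n"
      using \<epsilon> by (simp add: mult_left_le_one_le algebra_simps)
    ultimately show ?thesis
      using T unfolding tester_def by (metis bind_return_pmf subset_refl)
  qed
  hence "pmf ?p False \<le> \<delta>"
    using prob_bind_pmf_le[of "random_profile A n" "{}" "\<lambda>Q. run n Q T" "{False}" \<delta>] \<delta>(1)
    by (simp add: measure_pmf_single)
  moreover have "pmf ?p True \<le> \<delta>" using T by (simp add: tester_def)
  ultimately show False using \<delta>(2) by (simp add: pmf_False_conv_True)
qed

text \<open>The verdict 1 of the tester. All orders of \<open>X\<close> are inspected because the
  missing one depends on the unknown instance.\<close>

definition low_frequency :: "'a set \<Rightarrow> nat \<Rightarrow> real \<Rightarrow> 'a rel list \<Rightarrow> bool" where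
  "low_frequency X k \<theta> l \<longleftrightarrow> (\<exists>r\<in>prefs X. count_list l r / k \<le> \<theta>)"

text \<open>The bounds \<open>\<epsilon> / M\<close> and \<open>1 / M\<close> on the mean
  frequencies, with \<open>M = fact (card X)\<close>, differ by \<open>4 * \<eta>\<close>, so the
  threshold is \<open>2 * \<eta>\<close> from each: one \<open>\<eta>\<close> for the random
  instance, one for the sampling. \<open>K\<close> makes each of the two exponential tails at most
  \<open>\<delta> / (2 * M)\<close>.\<close>

lemma tester_gather:
  fixes D :: "'a rel set set" and X :: "'a set" and \<epsilon> \<delta> :: real
  defines "\<eta> \<equiv> (1 - \<epsilon>) / (4 * fact (card X))"
  defines "K \<equiv> ln (2 * fact (card X) / \<delta>) / (2 * \<eta>\<^sup>2)"
  assumes D: "normal_domain D" and A: "finite A" and X: "X \<subseteq> A" "X \<noteq> {}"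
    and con: "con D (card X) < 1" and ps: "set ps = X \<times> X"
    and \<epsilon>: "\<epsilon> < 1" and \<delta>: "\<delta> > 0"
    and n: "n > 0" "n \<ge> K" and k: "k > 0" "k \<ge> K"
  shows "tester \<epsilon> \<delta> D A n (gather k ps (low_frequency X k (1 / fact (card X) - 2 * \<eta>)))"
proof -
  let ?M = "fact (card X) :: real"
  let ?g = "low_frequency X k (1 / ?M - 2 * \<eta>)"
  have fX: "finite X" using X A finite_subset by blast
  have \<eta>: "\<eta> > 0" using \<epsilon> by (simp add: \<eta>_def)
  have exp_le: "exp (- 2 * j * \<eta>\<^sup>2) \<le> \<delta> / (2 * ?M)" if "j \<ge> K" for j :: real
  proof -
    have "ln (2 * ?M / \<delta>) \<le> 2 * j * \<eta>\<^sup>2"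
      using that \<eta> by (simp add: K_def field_simps)
    hence "exp (- 2 * j * \<eta>\<^sup>2) \<le> exp (- ln (2 * ?M / \<delta>))" by simp
    also have "\<dots> = \<delta> / (2 * ?M)" using \<delta> by (simp add: exp_minus)
    finally show ?thesis .
  qed
  have err: "exp (- 2 * n * \<eta>\<^sup>2) + exp (- 2 * k * \<eta>\<^sup>2) \<le> \<delta> / ?M"
    using exp_le[OF n(2)] exp_le[OF k(2)] by simp
  define p where "p W P i = (if i \<in> W then return_pmf (P i) else pmf_of_set (prefs A))"
    for W :: "nat set" and P :: "nat \<Rightarrow> 'a rel" and i
  define L where "L W P = bind_pmf (Pi_pmf {..<n} {} (p W P))
      (\<lambda>f. replicate_pmf k (map_pmf (\<lambda>i. Restr (f i) X) (pmf_of_set {..<n})))" for W P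
  have run: "bind_pmf (random_outliers A n W P) (\<lambda>Q. run n Q (gather k ps ?g)) = map_pmf ?g (L W P)"
    for W P
    unfolding random_outliers_def L_def p_def run_gather ps by (simp add: map_bind_pmf)
  note conc = sample_frequency_concentrated[OF n(1) k(1) less_imp_le[OF \<eta>],
      where g = "\<lambda>r. Restr r X" and d = "{}"]
  have uniform: "pmf (map_pmf (\<lambda>r. Restr r X) (pmf_of_set (prefs A))) r = 1 / ?M"
    if "r \<in> prefs X" for r
    using pmf_map_Restr_prefs[OF A X(1) that] .
  have "pmf (map_pmf ?g (L W P)) False \<le> \<delta>"
    if W: "W \<subseteq> {..<n}" "real (card W) \<ge> (1 - \<epsilon>) * n"
      and P: "profile_over A W P" "belongs D W P" for W P
  proof -
    obtain r where r: "r \<in> prefs X" "\<And>i. i \<in> W \<Longrightarrow> Restr (P i) X \<noteq> r"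
      using ex_missing_pref[OF D A X con finite_subset[OF W(1)] P] by blast
    let ?\<mu> = "(\<Sum>i<n. pmf (map_pmf (\<lambda>r. Restr r X) (p W P i)) r) / n"
    \<comment> \<open>Agents of \<open>W\<close> never show the missing order \<open>r\<close>; each
      outlier shows it with probability \<open>1 / M\<close>.\<close>
    have "(\<Sum>i<n. pmf (map_pmf (\<lambda>r. Restr r X) (p W P i)) r) = (\<Sum>i\<in>{..<n} - W. 1 / ?M)"
      using W(1) r by (intro sum.mono_neutral_cong_right) (auto simp: p_def uniform)
    also have "\<dots> = (real n - card W) / ?M"
      using W(1) by (simp add: card_Diff_subset finite_subset of_nat_diff card_mono[of "{..<n}", simplified])
    finally have "?\<mu> = (real n - card W) / n / ?M" by simp
    also have "\<dots> \<le> \<epsilon> / ?M"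
      using W(2) n(1) by (intro divide_right_mono) (auto simp: field_simps)
    also have "\<dots> = 1 / ?M - 4 * \<eta>" by (simp add: \<eta>_def field_simps)
    finally have \<mu>: "?\<mu> \<le> 1 / ?M - 4 * \<eta>" .
    have sub: "?g -` {False} \<subseteq> {l. count_list l r / k \<ge> ?\<mu> + 2 * \<eta>}"
    proof
      fix l assume "l \<in> ?g -` {False}"
      hence "count_list l r / k > 1 / ?M - 2 * \<eta>"
        using r(1) by (auto simp: low_frequency_def not_le)
      hence "count_list l r / k \<ge> ?\<mu> + 2 * \<eta>" using \<mu> by linarith
      thus "l \<in> {l. count_list l r / k \<ge> ?\<mu> + 2 * \<eta>}" by simp
    qed
    have "pmf (map_pmf ?g (L W P)) False = measure_pmf.prob (L W P) (?g -` {False})"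
      by (rule pmf_map)
    also have "\<dots> \<le> measure_pmf.prob (L W P) {l. count_list l r / k \<ge> ?\<mu> + 2 * \<eta>}"
      using sub by (rule measure_pmf.finite_measure_mono) simp
    also have "\<dots> \<le> \<delta> / ?M"
      using conc(1)[where p = "p W P" and r = r] err unfolding L_def by linarith
    also have "\<dots> \<le> \<delta>" using \<delta> by (simp add: divide_le_eq mult_le_cancel_left1)
    finally show ?thesis .
  qed
  moreover have "pmf (map_pmf ?g (L {} P)) True \<le> \<delta>" for P
  proof -
    have "pmf (map_pmf ?g (L {} P)) True = measure_pmf.prob (L {} P) (?g -` {True})"
      by (rule pmf_map)
    also have "?g -` {True} = (\<Union>r\<in>prefs X. {l. count_list l r / k \<le> 1 / ?M - 2 * \<eta>})"
      by (simp add: low_frequency_def set_eq_iff)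
    \<comment> \<open>A random profile is misjudged as soon as any of the \<open>M\<close> orders is
      rare, so a union bound is needed; this is why each order is allowed only the error
      \<open>\<delta> / M\<close>.\<close>
    also have "measure_pmf.prob (L {} P) \<dots> \<le>
        (\<Sum>r\<in>prefs X. measure_pmf.prob (L {} P) {l. count_list l r / k \<le> 1 / ?M - 2 * \<eta>})"
      by (rule measure_pmf.finite_measure_subadditive_finite) (auto simp: finite_prefs fX)
    also have "\<dots> \<le> (\<Sum>r\<in>prefs X. \<delta> / ?M)"
    proof (rule sum_mono)
      fix r assume "r \<in> prefs X"
      hence "(\<Sum>i<n. pmf (map_pmf (\<lambda>r. Restr r X) (p {} P i)) r) / n = 1 / ?M"
        using n(1) by (simp add: p_def uniform)
      with conc(2)[where p = "p {} P" and r = r] err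
      show "measure_pmf.prob (L {} P) {l. count_list l r / k \<le> 1 / ?M - 2 * \<eta>} \<le> \<delta> / ?M"
        unfolding L_def by simp
    qed
    also have "\<dots> = \<delta>" by (simp add: card_prefs[OF fX])
    finally show ?thesis .
  qed
  moreover have "random_profile A n = random_outliers A n {} (\<lambda>_. {})"
    by (simp add: random_profile_def random_outliers_def)
  moreover have "legal A (gather k ps ?g) {}"
    using ps X(1) by (intro legal_gather) auto
  ultimately show ?thesis
    unfolding tester_def by (simp add: run)
qed

text \<open>The bound \<open>K\<close> of \<open>tester_gather\<close> rounded up. It serves both as
  the number of sampled agents and as the least number of agents in the instance.\<close>

definition sample_size :: "nat \<Rightarrow> real \<Rightarrow> real \<Rightarrow> nat" where
  "sample_size m \<epsilon> \<delta> = nat \<lceil>ln (2 * fact m / \<delta>) / (2 * ((1 - \<epsilon>) / (4 * fact m))\<^sup>2)\<rceil>"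

lemma sample_size_pos:
  assumes "\<epsilon> < 1" "0 < \<delta>" "\<delta> < 1"
  shows "sample_size m \<epsilon> \<delta> > 0"
proof -
  have "\<delta> < 2 * fact m"
    using assms fact_ge_1[of m, where 'a = real] by linarith
  thus ?thesis
    using assms by (auto simp: sample_size_def intro!: divide_pos_pos ln_gt_zero)
qed

text \<open>As \<open>\<delta> < 1 / 2\<close>, the factor \<open>ln (1 / \<delta>)\<close> is at
  least \<open>1 / 2\<close>, so twice it absorbs both the additive term
  \<open>ln (2 * fact m)\<close> and, because \<open>1 / (1 - \<epsilon>)\<^sup>2\<close> is at
  least 1, the rounding up.\<close>

lemma sample_size_le:
  assumes \<epsilon>: "0 \<le> \<epsilon>" "\<epsilon> < 1" and \<delta>: "0 < \<delta>" "\<delta> < 1 / 2"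
  shows "sample_size m \<epsilon> \<delta> \<le>
    (8 * (fact m)\<^sup>2 * (2 * ln (2 * fact m) + 1) + 2) * (1 / (1 - \<epsilon>)\<^sup>2 * ln (1 / \<delta>))"
proof -
  define M l e where "M = (fact m :: real)" "l = ln (1 / \<delta>)" "e = 1 / (1 - \<epsilon>)\<^sup>2"
  have M: "M \<ge> 1" by (simp add: M_l_e_def)
  have "ln 2 \<le> l" using \<delta> by (simp add: M_l_e_def field_simps)
  hence l: "1 \<le> 2 * l" using ln2_ge_two_thirds by linarith
  have "(1 - \<epsilon>)\<^sup>2 \<le> 1" using \<epsilon> by (simp add: power_le_one)
  hence e: "1 \<le> e" using \<epsilon> by (simp add: M_l_e_def)
  have "2 * M / \<delta> = (2 * M) * (1 / \<delta>)" by simp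
  hence ln: "ln (2 * M / \<delta>) = ln (2 * M) + l"
    using M \<delta> unfolding M_l_e_def(2)
    by (metis ln_mult_pos divide_pos_pos less_le_trans mult_pos_pos
        zero_less_numeral zero_less_one)
  have "ln (2 * M) * 1 \<le> ln (2 * M) * (2 * l)"
    using l M by (intro mult_left_mono) auto
  hence "ln (2 * M / \<delta>) \<le> (2 * ln (2 * M) + 1) * l"
    using ln by (simp add: algebra_simps)
  hence "8 * M\<^sup>2 * e * ln (2 * M / \<delta>) \<le> 8 * M\<^sup>2 * e * ((2 * ln (2 * M) + 1) * l)"
    using e by (intro mult_left_mono) auto
  moreover have "ln (2 * M / \<delta>) / (2 * ((1 - \<epsilon>) / (4 * M))\<^sup>2) = 8 * M\<^sup>2 * e * ln (2 * M / \<delta>)"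
    by (simp add: M_l_e_def(3) power_divide power_mult_distrib)
  moreover have "1 * 1 \<le> (2 * l) * e" using l e by (intro mult_mono) auto
  moreover have "0 \<le> ln (2 * M / \<delta>)" using ln l M by (simp add: ln_ge_zero)
  hence "0 \<le> 8 * M\<^sup>2 * e * ln (2 * M / \<delta>)" using e by simp
  ultimately have "sample_size m \<epsilon> \<delta> \<le> 8 * M\<^sup>2 * e * ((2 * ln (2 * M) + 1) * l) + 2 * l * e"
    unfolding sample_size_def M_l_e_def(1)[symmetric] by linarith
  thus ?thesis unfolding M_l_e_def(1)[symmetric] M_l_e_def(2)[symmetric] M_l_e_def(3)[symmetric]
    by (simp add: algebra_simps)
qed

text \<open>\<open>C\<close> depends on the threshold alone and \<open>T\<close> works for all large
  \<open>n\<close>; the bound \<open>N\<close> lets the random instance itself concentrate. If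
  \<open>\<Union>D\<close> were empty, no instance of kind (i) with \<open>n > 0\<close> would exist
  and always answering 0 would be a tester, hence the assumption on it.\<close>

theorem corollary3p2:
  shows "\<exists>(C :: enat \<Rightarrow> real) (N :: enat \<Rightarrow> real \<Rightarrow> real \<Rightarrow> nat).
    \<forall>(D :: 'a::infinite rel set set) (A :: 'a set) (\<epsilon>::real) (\<delta>::real).
      is_domain D \<longrightarrow> \<Union>D \<noteq> {} \<longrightarrow> normal_domain D \<longrightarrow> neutral_domain D \<longrightarrow>
      finite A \<longrightarrow> A \<noteq> {} \<longrightarrow> 0 \<le> \<epsilon> \<longrightarrow> \<epsilon> < 1 \<longrightarrow> 0 < \<delta> \<longrightarrow> \<delta> < 1 / 2 \<longrightarrow>
        (m0 D \<le> enat (card A) \<longrightarrow>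
          (\<exists>T. ereal_of_enat (sample_complexity T)
                 \<le> ereal (C (m0 D) * (1 / (1 - \<epsilon>)\<^sup>2 * ln (1 / \<delta>))) \<and>
               (\<forall>n \<ge> N (m0 D) \<epsilon> \<delta>. tester \<epsilon> \<delta> D A n T))) \<and>
        (enat (card A) \<le> m0 D - 1 \<longrightarrow>
          (\<forall>n > 0. \<not> (\<exists>T. tester \<epsilon> \<delta> D A n T)))"
proof -
  define c where "c m = 8 * (fact m)\<^sup>2 * (2 * ln (2 * fact m) + 1) + (2 :: real)" for m
  \<comment> \<open>Each sampled agent answers one query per pair in \<open>X \<times> X\<close>,
    which gives the factor \<open>m * m\<close>.\<close>
  define C where "C e = real (the_enat e * the_enat e) * c (the_enat e)" for e
  define N where "N e = sample_size (the_enat e)" for e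
  show ?thesis
  proof (intro exI[of _ C] exI[of _ N] allI impI conjI)
    fix D :: "'a rel set set" and A :: "'a set" and \<epsilon> \<delta> :: real
    assume D: "is_domain D" "\<Union>D \<noteq> {}" "normal_domain D" "neutral_domain D"
      and A: "finite A" "A \<noteq> {}" and \<epsilon>: "0 \<le> \<epsilon>" "\<epsilon> < 1" and \<delta>: "0 < \<delta>" "\<delta> < 1 / 2"
    {
      assume le: "m0 D \<le> enat (card A)"
      let ?S = "{m. 0 < m \<and> con D m < 1}"
      obtain m' where "m' \<in> ?S"
      proof (cases "?S = {}")
        case True
        hence "m0 D = \<infinity>" unfolding m0_def by (simp only:) (simp add: top_enat_def)
        with le that show ?thesis by simp
      qed blast
      \<comment> \<open>The infimum is attained by well-ordering, so the content is below 1 at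
        \<open>m0 D\<close> itself.\<close>
      hence "m0 D \<in> enat ` ?S"
        unfolding m0_def by (intro wellorder_InfI[of "enat m'"] imageI)
      then obtain m where m: "m0 D = enat m" "0 < m" "con D m < 1" by auto
      obtain X where X: "X \<subseteq> A" "card X = m"
        using obtain_subset_with_card_n[of m A] le m(1) by auto
      hence X0: "X \<noteq> {}" "finite X" using m(2) A finite_subset by auto
      obtain ps where ps: "set ps = X \<times> X" "distinct ps"
        using finite_distinct_list[of "X \<times> X"] X0 by auto
      have len: "length ps = m * m"
        using distinct_card[OF ps(2)] ps(1) X(2) by (simp add: card_cartesian_product)
      let ?k = "sample_size m \<epsilon> \<delta>"
      define \<theta> where "\<theta> = 1 / fact (card X) - 2 * ((1 - \<epsilon>) / (4 * fact (card X)))"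
      let ?T = "gather ?k ps (low_frequency X ?k \<theta>)"
      have pos: "?k > 0" using sample_size_pos[of \<epsilon> \<delta> m] \<epsilon> \<delta> by simp
      have "tester \<epsilon> \<delta> D A n ?T" if "n \<ge> ?k" for n
        unfolding \<theta>_def
      proof (rule tester_gather[OF D(3) A(1) X(1) X0(1) _ ps(1) \<epsilon>(2) \<delta>(1)])
        show "con D (card X) < 1" using m(3) X(2) by simp
        show "ln (2 * fact (card X) / \<delta>) / (2 * ((1 - \<epsilon>) / (4 * fact (card X)))\<^sup>2) \<le> real ?k"
          unfolding X(2) sample_size_def by (rule of_nat_ceiling)
        thus "ln (2 * fact (card X) / \<delta>) / (2 * ((1 - \<epsilon>) / (4 * fact (card X)))\<^sup>2) \<le> real n"
          using that by linarith
      qed (use pos that in auto)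
      moreover have "ereal_of_enat (sample_complexity ?T) \<le>
          ereal (C (m0 D) * (1 / (1 - \<epsilon>)\<^sup>2 * ln (1 / \<delta>)))"
      proof -
        have "real (?k * (m * m)) \<le> C (m0 D) * (1 / (1 - \<epsilon>)\<^sup>2 * ln (1 / \<delta>))"
          using mult_left_mono[OF sample_size_le[OF \<epsilon> \<delta>, of m], of "real (m * m)"]
          by (simp add: C_def c_def m(1) mult_ac)
        moreover have "ereal_of_enat (sample_complexity ?T) \<le> ereal_of_enat (enat (?k * (m * m)))"
          using sample_complexity_gather[of ?k ps "low_frequency X ?k \<theta>"] len
          by (simp only: ereal_of_enat_le_iff)
        ultimately show ?thesis
          by (metis ereal_less_eq(3) ereal_of_enat_simps(1) order.trans)
      qed
      ultimately show "\<exists>T. ereal_of_enat (sample_complexity T)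
          \<le> ereal (C (m0 D) * (1 / (1 - \<epsilon>)\<^sup>2 * ln (1 / \<delta>))) \<and>
          (\<forall>n \<ge> N (m0 D) \<epsilon> \<delta>. tester \<epsilon> \<delta> D A n T)"
        unfolding N_def m(1) by auto
    next
      fix n :: nat assume le: "enat (card A) \<le> m0 D - 1"
      have "con D (card A) \<ge> 1"
      proof (rule ccontr)
        assume "\<not> con D (card A) \<ge> 1"
        moreover have "card A > 0" using A by auto
        ultimately have "m0 D \<le> enat (card A)"
          unfolding m0_def by (intro INF_lower) auto
        \<comment> \<open>Here \<open>m0 D\<close> is finite. Subtraction is truncated, so
          \<open>card A > 0\<close> is what excludes \<open>j = 0\<close>.\<close>
        then obtain j where j: "m0 D = enat j" "j \<le> card A"
          by (cases "m0 D") auto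
        with le \<open>card A > 0\<close> show False by (simp add: one_enat_def)
      qed
      then obtain B where "B \<in> D" "prefs A \<subseteq> B"
        using prefs_subset_domain[OF D A] by blast
      thus "\<not> (\<exists>T. tester \<epsilon> \<delta> D A n T)"
        using not_tester[OF A(1)] \<epsilon>(1) \<delta> by (metis less_imp_le)
    }
  qed
qed

end
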